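(* Let $\Upsilon = \Upsilon(v_1,\dots,v_m;\cdot)$ be a geometric interpolation function (geodesic or projection-based) for the values $v_1,\dots,v_m \in M$. The generalized Jacobi fields along $\Upsilon$ (i.e. the variations of $\Upsilon$) form a vector space $\mathcal{V}_\Upsilon$, which is isomorphic to $\prod_{i=1}^m T_{v_i}M$. The map $$\mathcal{T} : \prod_{i=1}^m T_{v_i}M \to \mathcal{V}_\Upsilon, \qquad \mathcal{T}[b_1,\dots,b_m](\xi) = \sum_{i=1}^m \frac{\partial \Upsilon(v_1,\dots,v_m;\xi)}{\partial v_i}\cdot b_i ,$$ for all $b_i \in T_{v_i}M$, $i=1,\dots,m$, and all $\xi$ in the reference element, is an isomorphism of vector spaces.
   Context: Reference element and shape functions. $T_{\mathrm{ref}} \subset \mathbb{R}^d$ is a bounded domain (the reference element), $a_1,\dots,a_m \in \overline{T_{\mathrm{ref}}}$ are distinct points (Lagrange nodes), and $\varphi_1,\dots,\varphi_m$ are scalar polynomial functions of order $p$ with $\varphi_i(a_j)=\delta_{ij}$. For given real values $v_i$ there is exactly one function in the span of the $\varphi_i$ attaining the value $v_i$ at $a_i$ for every $i$. Functions on the reference element are evaluated on the closure $\overline{T_{\mathrm{ref}}}$, so in particular at the nodes $a_j$. Manifold. $M$ is a smooth connected Riemannian manifold. Geometric interpolation. For $v=(v_1,\dots,v_m)\in M^m$, $\Upsilon(v;\xi)$ denotes one of the following two constructions (the same one throughout). (1) Geodesic interpolation. Here $M$ is complete, with a distance metric $\operatorname{dist}$ (the Riemannian distance), and $$\Upsilon^{\mathrm{ge}}(v,\xi)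 := \operatorname*{arg\,min}_{q\in M} \sum_{i=1}^m \varphi_i(\xi)\operatorname{dist}(v_i,q)^2 .$$ (2) Projection-based interpolation. Here $\imath: M\to\mathbb{R}^N$ is an isometric embedding and $\mathcal{P}: U\to M$ is a differentiable projection from a neighborhood $U\subset\mathbb{R}^N$ of $\imath(M)$ onto $M$ (so $\mathcal{P}(\imath(q))=q$ for $q\in M$), and $$\Upsilon^{\mathrm{pr}}(v,\xi) := \mathcal{P}\Big[\sum_{i=1}^m \varphi_i(\xi)\,\imath(v_i)\Big].$$ $P_p(M)$ denotes the space of all functions $\Upsilon(v;\cdot)$ obtained in this way for fixed $T_{\mathrm{ref}}$, $a_i$, $\varphi_i$. Standing assumption (well-posedness and local manifold structure). There is an open neighborhood $W\subset M^m$ of $(v_1,\dots,v_m)$ such that, for all $w\in W$ and all $\xi\in\overline{T_{\mathrm{ref}}}$, the value $\Upsilon(w;\xi)$ is well defined and single-valued and depends differentiably ($C^1$) on $w$. Near $\Upsilon(v;\cdot)$ the space $P_p(M)$ carries the manifold structure inherited from the nodal values: a curve $c:(-\epsilon,\epsilon)\to P_p(M)$ with $c(0)=\Upsilon(v;\cdot)$ is called differentiable if $c(t)=\Upsilon(C(t);\cdot)$ with a differentiable curve $C:(-\epsilon,\epsilon)\to W$, $C(0)=v$, where $C(t)$ is the tuple of values of $c(t)$ at the Lagrange nodes. $\frac{\partial\Upsilon(v_1,\dots,v_m;\xi)}{\partial v_i}: T_{v_i}M\to T_{\Upsilon(v;\xi)}M$ is the differential of $\Upsilon$ with respect to its $i$-th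 argument $v_i$. Variations / generalized Jacobi fields. A vector field $\eta$ along $\Upsilon=\Upsilon(v;\cdot)$ (that is, $\eta(\xi)\in T_{\Upsilon(v;\xi)}M$ for every $\xi$) is called a variation of $\Upsilon$, or generalized Jacobi field along $\Upsilon$, if there is a differentiable curve $c:(-\epsilon,\epsilon)\to P_p(M)$ with $c(0)=\Upsilon$ and $\dot c|_{t=0}(\xi)=\eta(\xi)$ for all $\xi$. The vector space operations on such fields are pointwise. *)

theory Defs
  imports "HOL-Analysis.Analysis" "HOL-Library.Function_Algebras"
begin

instantiation "fun" :: (type, real_vector) real_vector
begin

definition scaleR_fun_def: "r *\<^sub>R f = (\<lambda>x. r *\<^sub>R f x)"

instance
  by standard (simp_all add: scaleR_fun_def fun_eq_iff scaleR_add_right scaleR_add_left)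

end

text \<open>Isomorphism of vector spaces, where both spaces are linear subspaces of ambient real vector
  spaces and only the values of the map on the first one matter.\<close>

definition vector_space_iso_on ::
    "('x::real_vector \<Rightarrow> 'y::real_vector) \<Rightarrow> 'x set \<Rightarrow> 'y set \<Rightarrow> bool" where
  "vector_space_iso_on f V V' \<longleftrightarrow>
     subspace V \<and> subspace V' \<and>
     (\<forall>x\<in>V. \<forall>y\<in>V. f (x + y) = f x + f y) \<and>
     (\<forall>r. \<forall>x\<in>V. f (r *\<^sub>R x) = r *\<^sub>R f x) \<and>
     bij_betw f V V'"


section \<open>Smooth manifolds\<close>

text \<open>Functions of class \<open>C\<^sup>k\<close> on an open subset \<open>S\<close> of a finite-dimensional normed space: all
  iterated directional derivatives exist (as values of Frechet derivatives) and are continuous.\<close>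

primrec Ck_on :: "nat \<Rightarrow> 'e::real_normed_vector set \<Rightarrow> ('e \<Rightarrow> 'f::real_normed_vector) \<Rightarrow> bool" where
  "Ck_on 0 S f = continuous_on S f"
| "Ck_on (Suc k) S f =
     ((\<forall>x\<in>S. f differentiable (at x)) \<and>
      (\<forall>h. Ck_on k S (\<lambda>x. frechet_derivative f (at x) h)))"

definition smooth_on :: "'e::real_normed_vector set \<Rightarrow> ('e \<Rightarrow> 'f::real_normed_vector) \<Rightarrow> bool" where
  "smooth_on S f \<longleftrightarrow> (\<forall>k. Ck_on k S f)"

text \<open>A chart is a domain together with a coordinate map; the values of the coordinate map outside
  the domain are irrelevant.\<close>

type_synonym ('a, 'e) chart = "'a set \<times> ('a \<Rightarrow> 'e)"

definition chart_inv :: "('a, 'e) chart \<Rightarrow> 'e \<Rightarrow> 'a" where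
  "chart_inv c = inv_into (fst c) (snd c)"

definition is_chart :: "('a::topological_space, 'e::real_normed_vector) chart \<Rightarrow> bool" where
  "is_chart c \<longleftrightarrow> open (fst c) \<and> open (snd c ` fst c) \<and>
     homeomorphism (fst c) (snd c ` fst c) (snd c) (chart_inv c)"

text \<open>The manifold is the whole (Hausdorff, second countable) type \<open>'a\<close>. The atlas need not be
  maximal. The model space is a finite-dimensional normed space rather than a type of class
  \<open>euclidean_space\<close>, as the latter excludes dimension zero.\<close>

definition smooth_manifold ::
    "('a::{t2_space,second_countable_topology}, 'e::real_normed_vector) chart set \<Rightarrow> bool" where
  "smooth_manifold A \<longleftrightarrow>
     (\<exists>B::'e set. finite B \<and> span B = UNIV) \<and>
     (\<forall>c\<in>A. is_chart c) \<and> \<Union> (fst ` A) = UNIV \<and>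
     (\<forall>c\<in>A. \<forall>c'\<in>A. smooth_on (snd c ` (fst c \<inter> fst c')) (snd c' \<circ> chart_inv c))"

definition flat_chart :: "('e, 'e) chart" where
  "flat_chart = (UNIV, id)"

definition flat_atlas :: "('e, 'e) chart set" where
  "flat_atlas = {flat_chart}"

definition prod_chart :: "('m::finite \<Rightarrow> ('a, 'e) chart) \<Rightarrow> ('a ^ 'm, 'e ^ 'm) chart" where
  "prod_chart cs = ({w. \<forall>i. w $ i \<in> fst (cs i)}, \<lambda>w. \<chi> i. snd (cs i) (w $ i))"

definition prod_atlas :: "('a, 'e) chart set \<Rightarrow> ('a ^ 'm::finite, 'e ^ 'm) chart set" where
  "prod_atlas A = prod_chart ` {cs. range cs \<subseteq> A}"

text \<open>Differentiable maps and maps of class \<open>C\<^sup>k\<close>, defined on an open set \<open>S\<close> of points.\<close>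

definition differentiable_map ::
    "('a::topological_space, 'e::real_normed_vector) chart set \<Rightarrow>
     ('b::topological_space, 'f::real_normed_vector) chart set \<Rightarrow> 'a set \<Rightarrow> ('a \<Rightarrow> 'b) \<Rightarrow> bool" where
  "differentiable_map A B S f \<longleftrightarrow> continuous_on S f \<and>
     (\<forall>c\<in>A. \<forall>c'\<in>B. \<forall>p \<in> S \<inter> fst c. f p \<in> fst c' \<longrightarrow>
        (snd c' \<circ> f \<circ> chart_inv c) differentiable (at (snd c p)))"

definition Ck_map ::
    "nat \<Rightarrow> ('a::topological_space, 'e::real_normed_vector) chart set \<Rightarrow>
     ('b::topological_space, 'f::real_normed_vector) chart set \<Rightarrow> 'a set \<Rightarrow> ('a \<Rightarrow> 'b) \<Rightarrow> bool" where
  "Ck_map k A B S f \<longleftrightarrow> continuous_on S f \<and>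
     (\<forall>c\<in>A. \<forall>c'\<in>B. Ck_on k (snd c ` (S \<inter> fst c \<inter> f -` fst c')) (snd c' \<circ> f \<circ> chart_inv c))"


section \<open>Tangent vectors\<close>

text \<open>A tangent vector at \<open>p\<close> is the family of its coordinate vectors in all charts around \<open>p\<close>,
  related by the derivatives of the transition maps; entries at other charts are zero.\<close>

type_synonym ('a, 'e) tvec = "('a, 'e) chart \<Rightarrow> 'e"

definition tangent_space ::
    "('a, 'e::real_normed_vector) chart set \<Rightarrow> 'a \<Rightarrow> ('a, 'e) tvec set" where
  "tangent_space A p = {X.
     (\<forall>c. \<not> (c \<in> A \<and> p \<in> fst c) \<longrightarrow> X c = 0) \<and>
     (\<forall>c\<in>A. \<forall>c'\<in>A. p \<in> fst c \<inter> fst c' \<longrightarrow>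
        X c' = frechet_derivative (snd c' \<circ> chart_inv c) (at (snd c p)) (X c))}"

definition coord_tvec ::
    "('a, 'e::real_normed_vector) chart set \<Rightarrow> ('a, 'e) chart \<Rightarrow> 'a \<Rightarrow> 'e \<Rightarrow> ('a, 'e) tvec" where
  "coord_tvec A c p u = (\<lambda>c'. if c' \<in> A \<and> p \<in> fst c'
     then frechet_derivative (snd c' \<circ> chart_inv c) (at (snd c p)) u else 0)"

text \<open>The differential at \<open>p\<close> of a map between manifolds; by the chain rule the result does not
  depend on the choice of the chart \<open>c\<close> around \<open>p\<close>.\<close>

definition differential ::
    "('a, 'e::real_normed_vector) chart set \<Rightarrow> ('b, 'f::real_normed_vector) chart set \<Rightarrow>
     ('a \<Rightarrow> 'b) \<Rightarrow> 'a \<Rightarrow> ('a, 'e) tvec \<Rightarrow> ('b, 'f) tvec" where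
  "differential A B f p X = (let c = (SOME c. c \<in> A \<and> p \<in> fst c) in
     (\<lambda>c'. if c' \<in> B \<and> f p \<in> fst c'
        then frechet_derivative (snd c' \<circ> f \<circ> chart_inv c) (at (snd c p)) (X c) else 0))"

text \<open>\<open>X\<close> is the velocity at time \<open>t\<close> of the curve \<open>\<gamma>\<close> defined on the interval \<open>I\<close> (one-sided at end
  points of \<open>I\<close>).\<close>

definition has_velocity ::
    "('a::topological_space, 'e::real_normed_vector) chart set \<Rightarrow> (real \<Rightarrow> 'a) \<Rightarrow> real set \<Rightarrow> real \<Rightarrow>
     ('a, 'e) tvec \<Rightarrow> bool" where
  "has_velocity A \<gamma> I t X \<longleftrightarrow>
     continuous (at t within I) \<gamma> \<and> X \<in> tangent_space A (\<gamma> t) \<and>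
     (\<forall>c\<in>A. \<gamma> t \<in> fst c \<longrightarrow> ((snd c \<circ> \<gamma>) has_vector_derivative X c) (at t within I))"

definition velocity ::
    "('a::topological_space, 'e::real_normed_vector) chart set \<Rightarrow> (real \<Rightarrow> 'a) \<Rightarrow> real set \<Rightarrow> real \<Rightarrow>
     ('a, 'e) tvec" where
  "velocity A \<gamma> I t = (THE X. has_velocity A \<gamma> I t X)"


section \<open>Riemannian manifolds\<close>

type_synonym ('a, 'e) metric_tensor = "'a \<Rightarrow> ('a, 'e) tvec \<Rightarrow> ('a, 'e) tvec \<Rightarrow> real"

definition riemannian_metric ::
    "('a, 'e::real_normed_vector) chart set \<Rightarrow> ('a, 'e) metric_tensor \<Rightarrow> bool" where
  "riemannian_metric A g \<longleftrightarrow>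
     (\<forall>p. \<forall>X\<in>tangent_space A p. \<forall>Y\<in>tangent_space A p. \<forall>Z\<in>tangent_space A p. \<forall>r.
        g p X Y = g p Y X \<and>
        g p (X + Y) Z = g p X Z + g p Y Z \<and>
        g p (r *\<^sub>R X) Y = r * g p X Y \<and>
        (X \<noteq> 0 \<longrightarrow> g p X X > 0)) \<and>
     (\<forall>c\<in>A. \<forall>u w. smooth_on (snd c ` fst c)
        (\<lambda>x. g (chart_inv c x) (coord_tvec A c (chart_inv c x) u) (coord_tvec A c (chart_inv c x) w)))"

definition riemannian_manifold ::
    "('a::{t2_space,second_countable_topology}, 'e::real_normed_vector) chart set \<Rightarrow>
     ('a, 'e) metric_tensor \<Rightarrow> bool" where
  "riemannian_manifold A g \<longleftrightarrow> smooth_manifold A \<and> riemannian_metric A g"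

definition C1_curve ::
    "('a::topological_space, 'e::real_normed_vector) chart set \<Rightarrow> real \<Rightarrow> real \<Rightarrow> (real \<Rightarrow> 'a) \<Rightarrow> bool" where
  "C1_curve A s t \<gamma> \<longleftrightarrow>
     (\<forall>\<tau>\<in>{s..t}. \<exists>X. has_velocity A \<gamma> {s..t} \<tau> X) \<and>
     (\<forall>c\<in>A. continuous_on {\<tau>\<in>{s..t}. \<gamma> \<tau> \<in> fst c} (\<lambda>\<tau>. velocity A \<gamma> {s..t} \<tau> c))"

text \<open>Finitely many break points \<open>S\<close>; the curve is \<open>C\<^sup>1\<close>, with one-sided derivatives at the end points,
  on each closed subinterval having no break point in its interior.\<close>

definition piecewise_C1_curve ::
    "('a::topological_space, 'e::real_normed_vector) chart set \<Rightarrow> (real \<Rightarrow> 'a) \<Rightarrow> bool" where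
  "piecewise_C1_curve A \<gamma> \<longleftrightarrow> continuous_on {0..1} \<gamma> \<and>
     (\<exists>S. finite S \<and>
        (\<forall>s t. 0 \<le> s \<and> s < t \<and> t \<le> 1 \<and> {s<..<t} \<inter> S = {} \<longrightarrow> C1_curve A s t \<gamma>))"

definition curve_length ::
    "('a::topological_space, 'e::real_normed_vector) chart set \<Rightarrow> ('a, 'e) metric_tensor \<Rightarrow>
     (real \<Rightarrow> 'a) \<Rightarrow> real" where
  "curve_length A g \<gamma> =
     integral {0..1} (\<lambda>t. sqrt (g (\<gamma> t) (velocity A \<gamma> {0..1} t) (velocity A \<gamma> {0..1} t)))"

definition riemannian_dist ::
    "('a::topological_space, 'e::real_normed_vector) chart set \<Rightarrow> ('a, 'e) metric_tensor \<Rightarrow>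
     'a \<Rightarrow> 'a \<Rightarrow> real" where
  "riemannian_dist A g p q =
     Inf {curve_length A g \<gamma> | \<gamma>. piecewise_C1_curve A \<gamma> \<and> \<gamma> 0 = p \<and> \<gamma> 1 = q}"

definition riemannian_complete ::
    "('a::topological_space, 'e::real_normed_vector) chart set \<Rightarrow> ('a, 'e) metric_tensor \<Rightarrow> bool" where
  "riemannian_complete A g \<longleftrightarrow>
     (\<forall>x :: nat \<Rightarrow> 'a.
        (\<forall>e>0. \<exists>N. \<forall>i\<ge>N. \<forall>j\<ge>N. riemannian_dist A g (x i) (x j) < e) \<longrightarrow>
        (\<exists>l. (\<lambda>n. riemannian_dist A g (x n) l) \<longlonglongrightarrow> 0))"

text \<open>The immersion property follows from preservation of the metric.\<close>

definition isometric_embedding ::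
    "('a::{t2_space,second_countable_topology}, 'e::real_normed_vector) chart set \<Rightarrow>
     ('a, 'e) metric_tensor \<Rightarrow> ('a \<Rightarrow> 'f::euclidean_space) \<Rightarrow> bool" where
  "isometric_embedding A g \<iota> \<longleftrightarrow>
     (\<forall>k. Ck_map k A flat_atlas UNIV \<iota>) \<and>
     homeomorphism UNIV (range \<iota>) \<iota> (inv \<iota>) \<and>
     (\<forall>p. \<forall>X\<in>tangent_space A p. \<forall>Y\<in>tangent_space A p.
        g p X Y = differential A flat_atlas \<iota> p X flat_chart \<bullet> differential A flat_atlas \<iota> p Y flat_chart)"

definition differentiable_projection ::
    "('a::{t2_space,second_countable_topology}, 'e::real_normed_vector) chart set \<Rightarrow>
     ('a \<Rightarrow> 'f::euclidean_space) \<Rightarrow> 'f set \<Rightarrow> ('f \<Rightarrow> 'a) \<Rightarrow> bool" where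
  "differentiable_projection A \<iota> U P \<longleftrightarrow>
     open U \<and> range \<iota> \<subseteq> U \<and> differentiable_map flat_atlas A U P \<and> (\<forall>q. P (\<iota> q) = q)"


section \<open>Geometric interpolation\<close>

definition polynomial_of_order :: "nat \<Rightarrow> (real ^ 'd::finite \<Rightarrow> real) \<Rightarrow> bool" where
  "polynomial_of_order p f \<longleftrightarrow>
     (\<exists>coeff. \<forall>x. f x =
        (\<Sum>\<alpha>\<in>{\<alpha>::'d \<Rightarrow> nat. (\<Sum>j\<in>UNIV. \<alpha> j) \<le> p}. coeff \<alpha> * (\<Prod>j\<in>UNIV. (x $ j) ^ \<alpha> j)))"

definition lagrange_basis ::
    "nat \<Rightarrow> (real ^ 'd::finite) set \<Rightarrow> ('m::finite \<Rightarrow> real ^ 'd) \<Rightarrow> ('m \<Rightarrow> real ^ 'd \<Rightarrow> real) \<Rightarrow> bool" where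
  "lagrange_basis p T a \<phi> \<longleftrightarrow>
     inj a \<and> range a \<subseteq> closure T \<and>
     (\<forall>i. polynomial_of_order p (\<phi> i)) \<and>
     (\<forall>i j. \<phi> i (a j) = (if i = j then 1 else 0))"

text \<open>The two constructions as relations: \<open>q\<close> is a value of the interpolation of \<open>v\<close> at \<open>\<xi>\<close>. Being well
  defined and single-valued at \<open>(v, \<xi>)\<close> means that there is exactly one such \<open>q\<close>.\<close>

type_synonym ('a, 'm, 'd) interpolation_rule = "'a ^ 'm \<Rightarrow> real ^ 'd \<Rightarrow> 'a \<Rightarrow> bool"

definition geodesic_rule ::
    "('a::topological_space, 'e::real_normed_vector) chart set \<Rightarrow> ('a, 'e) metric_tensor \<Rightarrow>
     ('m::finite \<Rightarrow> real ^ 'd::finite \<Rightarrow> real) \<Rightarrow> ('a, 'm, 'd) interpolation_rule" where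
  "geodesic_rule A g \<phi> v \<xi> q \<longleftrightarrow>
     is_arg_min (\<lambda>q. \<Sum>i\<in>UNIV. \<phi> i \<xi> * (riemannian_dist A g (v $ i) q)\<^sup>2) (\<lambda>_. True) q"

definition projection_rule ::
    "('a \<Rightarrow> 'f::euclidean_space) \<Rightarrow> 'f set \<Rightarrow> ('f \<Rightarrow> 'a) \<Rightarrow>
     ('m::finite \<Rightarrow> real ^ 'd::finite \<Rightarrow> real) \<Rightarrow> ('a, 'm, 'd) interpolation_rule" where
  "projection_rule \<iota> U P \<phi> v \<xi> q \<longleftrightarrow>
     (\<Sum>i\<in>UNIV. \<phi> i \<xi> *\<^sub>R \<iota> (v $ i)) \<in> U \<and> q = P (\<Sum>i\<in>UNIV. \<phi> i \<xi> *\<^sub>R \<iota> (v $ i))"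

definition geometric_interpolation_rule ::
    "('a::{t2_space,second_countable_topology}, 'e::real_normed_vector) chart set \<Rightarrow>
     ('a, 'e) metric_tensor \<Rightarrow> ('a \<Rightarrow> 'f::euclidean_space) \<Rightarrow> 'f set \<Rightarrow> ('f \<Rightarrow> 'a) \<Rightarrow>
     ('m::finite \<Rightarrow> real ^ 'd::finite \<Rightarrow> real) \<Rightarrow> ('a, 'm, 'd) interpolation_rule \<Rightarrow> bool" where
  "geometric_interpolation_rule A g \<iota> U P \<phi> R \<longleftrightarrow>
     (riemannian_complete A g \<and> R = geodesic_rule A g \<phi>) \<or>
     (isometric_embedding A g \<iota> \<and> differentiable_projection A \<iota> U P \<and> R = projection_rule \<iota> U P \<phi>)"

definition interp :: "('a, 'm::finite, 'd::finite) interpolation_rule \<Rightarrow> 'a ^ 'm \<Rightarrow> real ^ 'd \<Rightarrow> 'a" where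
  "interp R v \<xi> = (THE q. R v \<xi> q)"

definition interp_fun ::
    "('a, 'm::finite, 'd::finite) interpolation_rule \<Rightarrow> (real ^ 'd) set \<Rightarrow> 'a ^ 'm \<Rightarrow> real ^ 'd \<Rightarrow> 'a" where
  "interp_fun R T v = restrict (interp R v) (closure T)"

definition interp_space ::
    "('a, 'm::finite, 'd::finite) interpolation_rule \<Rightarrow> (real ^ 'd) set \<Rightarrow> (real ^ 'd \<Rightarrow> 'a) set" where
  "interp_space R T = {interp_fun R T w | w. \<forall>\<xi>\<in>closure T. \<exists>!q. R w \<xi> q}"

definition well_posed_on ::
    "('a::topological_space, 'e::real_normed_vector) chart set \<Rightarrow>
     ('a, 'm::finite, 'd::finite) interpolation_rule \<Rightarrow> (real ^ 'd) set \<Rightarrow> ('a ^ 'm) set \<Rightarrow> bool" where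
  "well_posed_on A R T W \<longleftrightarrow> (\<forall>\<xi>\<in>closure T.
     (\<forall>w\<in>W. \<exists>!q. R w \<xi> q) \<and> Ck_map 1 (prod_atlas A) A W (\<lambda>w. interp R w \<xi>))"


section \<open>Variations\<close>

definition differentiable_interp_curve ::
    "('a::topological_space, 'e::real_normed_vector) chart set \<Rightarrow>
     ('a, 'm::finite, 'd::finite) interpolation_rule \<Rightarrow> (real ^ 'd) set \<Rightarrow> ('m \<Rightarrow> real ^ 'd) \<Rightarrow>
     ('a ^ 'm) set \<Rightarrow> 'a ^ 'm \<Rightarrow> real \<Rightarrow> (real \<Rightarrow> real ^ 'd \<Rightarrow> 'a) \<Rightarrow> bool" where
  "differentiable_interp_curve A R T a W v \<epsilon> c \<longleftrightarrow>
     (\<forall>t\<in>{-\<epsilon><..<\<epsilon>}. c t \<in> interp_space R T) \<and>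
     (\<exists>C. C 0 = v \<and> differentiable_map flat_atlas (prod_atlas A) {-\<epsilon><..<\<epsilon>} C \<and>
        (\<forall>t\<in>{-\<epsilon><..<\<epsilon>}. C t \<in> W \<and> c t = interp_fun R T (C t) \<and> C t = (\<chi> j. c t (a j))))"

text \<open>Fields along a function on the closed reference element; they are extended by zero so that
  pointwise operations on fields are those of the function type.\<close>

definition fields_along ::
    "('a, 'e::real_normed_vector) chart set \<Rightarrow> (real ^ 'd::finite) set \<Rightarrow> (real ^ 'd \<Rightarrow> 'a) \<Rightarrow>
     (real ^ 'd \<Rightarrow> ('a, 'e) tvec) set" where
  "fields_along A T f = {\<eta>. (\<forall>\<xi>\<in>closure T. \<eta> \<xi> \<in> tangent_space A (f \<xi>)) \<and> (\<forall>\<xi>. \<xi> \<notin> closure T \<longrightarrow> \<eta> \<xi> = 0)}"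

definition variations ::
    "('a::topological_space, 'e::real_normed_vector) chart set \<Rightarrow>
     ('a, 'm::finite, 'd::finite) interpolation_rule \<Rightarrow> (real ^ 'd) set \<Rightarrow> ('m \<Rightarrow> real ^ 'd) \<Rightarrow>
     ('a ^ 'm) set \<Rightarrow> 'a ^ 'm \<Rightarrow> (real ^ 'd \<Rightarrow> ('a, 'e) tvec) set" where
  "variations A R T a W v = {\<eta> \<in> fields_along A T (interp_fun R T v).
     \<exists>\<epsilon>>0. \<exists>c. c 0 = interp_fun R T v \<and> differentiable_interp_curve A R T a W v \<epsilon> c \<and>
       (\<forall>\<xi>\<in>closure T. has_velocity A (\<lambda>t. c t \<xi>) {-\<epsilon><..<\<epsilon>} 0 (\<eta> \<xi>))}"

definition nodal_tangent_space ::
    "('a, 'e::real_normed_vector) chart set \<Rightarrow> 'a ^ 'm::finite \<Rightarrow> (('a, 'e) tvec ^ 'm) set" where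
  "nodal_tangent_space A v = {b. \<forall>i. b $ i \<in> tangent_space A (v $ i)}"

definition interp_partial ::
    "('a, 'e::real_normed_vector) chart set \<Rightarrow> ('a, 'm::finite, 'd::finite) interpolation_rule \<Rightarrow>
     'a ^ 'm \<Rightarrow> real ^ 'd \<Rightarrow> 'm \<Rightarrow> ('a, 'e) tvec \<Rightarrow> ('a, 'e) tvec" where
  "interp_partial A R v \<xi> i =
     differential A A (\<lambda>q. interp R (\<chi> j. if j = i then q else v $ j) \<xi>) (v $ i)"

definition variation_map ::
    "('a, 'e::real_normed_vector) chart set \<Rightarrow> ('a, 'm::finite, 'd::finite) interpolation_rule \<Rightarrow>
     (real ^ 'd) set \<Rightarrow> 'a ^ 'm \<Rightarrow> ('a, 'e) tvec ^ 'm \<Rightarrow> real ^ 'd \<Rightarrow> ('a, 'e) tvec" where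
  "variation_map A R T v b \<xi> =
     (if \<xi> \<in> closure T then (\<Sum>i\<in>UNIV. interp_partial A R v \<xi> i (b $ i)) else 0)"

end

theory Submission
  imports Defs
begin

text \<open>The inverse of \<open>\<T>\<close> is evaluation at the nodes: \<open>\<eta> \<mapsto> (\<eta>(a\<^sub>1), \<dots>, \<eta>(a\<^sub>m))\<close>. Two facts make this work.

  The first is the chain rule \<open>has_velocity_compose\<close>. If a curve \<open>C\<close> of nodal values has the component
  velocities \<open>b\<^sub>i\<close> at time zero, then for each \<open>\<xi>\<close> the curve \<open>t \<mapsto> \<Upsilon>(C(t); \<xi>)\<close> has the velocity
  \<open>\<T>[b](\<xi>)\<close>, because the total differential of \<open>\<Upsilon>(\<cdot>; \<xi>)\<close> is the sum of its partial differentials. Every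
  \<open>b\<close> is the velocity of some curve of nodal values (\<open>nodal_curve_exists\<close>: straight lines in charts), so \<open>\<T>\<close>
  maps into the variations. Conversely a variation \<open>\<eta>\<close> comes from a curve of nodal values, the
  velocity of which is \<open>(\<eta>(a\<^sub>j))\<^sub>j\<close>, so \<open>\<eta> = \<T>[(\<eta>(a\<^sub>j))\<^sub>j]\<close>.

  The second is that the interpolation reproduces the nodal values,
  \<open>\<Upsilon>(w; a\<^sub>j) = w\<^sub>j\<close> (\<open>geometric_interpolation_rule_node\<close>). Differentiating this along a curve gives
  \<open>\<T>[b](a\<^sub>j) = b\<^sub>j\<close>. For geodesic interpolation it rests on \<open>dist(q, q) = 0\<close>, hence on the fact that curve
  lengths are nonnegative.

  It is only here that the two constructions differ; the rest of the argument treats any rule that is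
  well posed near \<open>v\<close> and reproduces nodal values (the locale \<open>nodal_interpolation\<close>). That the variations
  form a vector space comes last: they are the image of a linear map.\<close>


section \<open>Charts\<close>

lemma chart_inv_left:
  assumes "is_chart c" and "q \<in> fst c"
  shows "chart_inv c (snd c q) = q"
  using assms unfolding is_chart_def by (auto dest: homeomorphism_apply1)

lemma chart_inv_right:
  assumes "is_chart c" and "x \<in> snd c ` fst c"
  shows "snd c (chart_inv c x) = x" and "chart_inv c x \<in> fst c"
  using assms unfolding is_chart_def by (auto simp: homeomorphism_def)

lemma chart_inv_continuous:
  assumes "is_chart c"
  shows "continuous_on (snd c ` fst c) (chart_inv c)"
  using assms unfolding is_chart_def by (auto dest: homeomorphism_cont2)

lemma smooth_manifold_chart:
  assumes "smooth_manifold A" and "c \<in> A"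
  shows "is_chart c"
  using assms by (auto simp: smooth_manifold_def)

lemma chart_open_domain: "is_chart c \<Longrightarrow> open (fst c)"
  by (simp add: is_chart_def)

lemma chart_open_image: "is_chart c \<Longrightarrow> open (snd c ` fst c)"
  by (simp add: is_chart_def)

lemma smooth_on_differentiable:
  assumes "smooth_on S f" and "x \<in> S"
  shows "f differentiable (at x)"
proof -
  have "Ck_on (Suc 0) S f"
    using assms(1) unfolding smooth_on_def by blast
  then show ?thesis using assms(2) by simp
qed

lemma transition_has_derivative:
  assumes "smooth_manifold A" and "c \<in> A" and "c' \<in> A" and "q \<in> fst c" and "q \<in> fst c'"
  shows "((snd c' \<circ> chart_inv c) has_derivative
           frechet_derivative (snd c' \<circ> chart_inv c) (at (snd c q))) (at (snd c q))"
proof -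
  have "smooth_on (snd c ` (fst c \<inter> fst c')) (snd c' \<circ> chart_inv c)"
    using assms by (auto simp: smooth_manifold_def)
  then show ?thesis
    using assms smooth_on_differentiable frechet_derivative_works by blast
qed

text \<open>The chart in which \<open>differential\<close> reads off its argument.\<close>

definition base_chart :: "('a, 'e) chart set \<Rightarrow> 'a \<Rightarrow> ('a, 'e) chart" where
  "base_chart A q = (SOME c. c \<in> A \<and> q \<in> fst c)"

lemma base_chart:
  assumes "smooth_manifold A"
  shows "base_chart A q \<in> A" and "q \<in> fst (base_chart A q)"
proof -
  have "q \<in> \<Union> (fst ` A)"
    using assms by (simp add: smooth_manifold_def)
  then have "\<exists>c. c \<in> A \<and> q \<in> fst c" by blast
  then have "base_chart A q \<in> A \<and> q \<in> fst (base_chart A q)"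
    unfolding base_chart_def by (rule someI_ex)
  then show "base_chart A q \<in> A" and "q \<in> fst (base_chart A q)" by auto
qed


section \<open>Tangent vectors and velocities\<close>

lemma tangent_vector_outside:
  assumes "X \<in> tangent_space A q" and "\<not> (c \<in> A \<and> q \<in> fst c)"
  shows "X c = 0"
  using assms unfolding tangent_space_def by blast

lemma tangent_vector_change_chart:
  assumes "X \<in> tangent_space A q" and "c \<in> A" and "c' \<in> A" and "q \<in> fst c" and "q \<in> fst c'"
  shows "X c' = frechet_derivative (snd c' \<circ> chart_inv c) (at (snd c q)) (X c)"
  using assms unfolding tangent_space_def by blast

lemma zero_tangent:
  assumes "smooth_manifold A"
  shows "0 \<in> tangent_space A q"
proof -
  have "frechet_derivative (snd c' \<circ> chart_inv c) (at (snd c q)) 0 = 0"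
    if "c \<in> A" "c' \<in> A" "q \<in> fst c" "q \<in> fst c'" for c c'
    using has_derivative_linear[OF transition_has_derivative[OF assms that]] by (rule linear_0)
  then show ?thesis by (auto simp: tangent_space_def)
qed

lemma subspace_tangent_space:
  assumes "smooth_manifold A"
  shows "subspace (tangent_space A q)"
proof -
  have lin: "linear (frechet_derivative (snd c' \<circ> chart_inv c) (at (snd c q)))"
    if "c \<in> A" "c' \<in> A" "q \<in> fst c" "q \<in> fst c'" for c c'
    by (rule has_derivative_linear[OF transition_has_derivative[OF assms that]])
  show ?thesis
  proof (rule subspaceI[OF zero_tangent[OF assms]])
    fix X Y assume X: "X \<in> tangent_space A q" and Y: "Y \<in> tangent_space A q"
    show "X + Y \<in> tangent_space A q"
      unfolding tangent_space_def mem_Collect_eq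
    proof (intro conjI allI ballI impI)
      show "(X + Y) c = 0" if "\<not> (c \<in> A \<and> q \<in> fst c)" for c
        using tangent_vector_outside[OF X that] tangent_vector_outside[OF Y that] by simp
      show "(X + Y) c' = frechet_derivative (snd c' \<circ> chart_inv c) (at (snd c q)) ((X + Y) c)"
        if "c \<in> A" "c' \<in> A" "q \<in> fst c \<inter> fst c'" for c c'
        using that tangent_vector_change_chart[OF X, of c c']
          tangent_vector_change_chart[OF Y, of c c'] linear_add[OF lin, of c c' "X c" "Y c"]
        by simp
    qed
  next
    fix r and X assume X: "X \<in> tangent_space A q"
    show "r *\<^sub>R X \<in> tangent_space A q"
      unfolding tangent_space_def mem_Collect_eq
    proof (intro conjI allI ballI impI)
      show "(r *\<^sub>R X) c = 0" if "\<not> (c \<in> A \<and> q \<in> fst c)" for c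
        using tangent_vector_outside[OF X that] by (simp add: scaleR_fun_def)
      show "(r *\<^sub>R X) c' = frechet_derivative (snd c' \<circ> chart_inv c) (at (snd c q)) ((r *\<^sub>R X) c)"
        if "c \<in> A" "c' \<in> A" "q \<in> fst c \<inter> fst c'" for c c'
        using that tangent_vector_change_chart[OF X, of c c'] linear_cmul[OF lin, of c c' r "X c"]
        by (simp add: scaleR_fun_def)
    qed
  qed
qed

lemma has_vector_derivative_chain_eventually:
  assumes "(f has_vector_derivative u) (at t)" and "(G has_derivative D) (at (f t))"
    and ev: "\<forall>\<^sub>F s in nhds t. G (f s) = h s"
  shows "(h has_vector_derivative D u) (at t)"
proof -
  have "((G \<circ> f) has_vector_derivative D u) (at t)"
    using assms(1,2) by (rule vector_derivative_diff_chain_within[OF _ has_derivative_at_withinI])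
  moreover have "\<forall>\<^sub>F s in nhds t. s \<in> UNIV \<longrightarrow> (G \<circ> f) s = h s"
    using ev by eventually_elim simp
  moreover have "(G \<circ> f) t = h t"
    using eventually_nhds_x_imp_x[OF ev] by simp
  ultimately show ?thesis
    using has_vector_derivative_cong_ev by blast
qed

lemma eventually_in_open:
  assumes "continuous (at t) \<gamma>" and "open S" and "\<gamma> t \<in> S"
  shows "\<forall>\<^sub>F s in nhds t. \<gamma> s \<in> S"
  using topological_tendstoD[OF assms(1)[unfolded continuous_at] assms(2,3)] assms(3)
  by (simp add: eventually_nhds_conv_at)

text \<open>The chain rule for a change of coordinates. Continuity of the curve is what keeps it inside the
  first chart near the given time.\<close>

lemma curve_derivative_change_chart:
  assumes A: "smooth_manifold A" "c \<in> A" "c' \<in> A"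
    and cont: "continuous (at t) \<gamma>" and in_charts: "\<gamma> t \<in> fst c" "\<gamma> t \<in> fst c'"
    and deriv: "((snd c \<circ> \<gamma>) has_vector_derivative u) (at t)"
  shows "((snd c' \<circ> \<gamma>) has_vector_derivative
           frechet_derivative (snd c' \<circ> chart_inv c) (at (snd c (\<gamma> t))) u) (at t)"
proof -
  have ch: "is_chart c" by (rule smooth_manifold_chart[OF A(1,2)])
  show ?thesis
  proof (rule has_vector_derivative_chain_eventually[OF deriv])
    show "((snd c' \<circ> chart_inv c) has_derivative
        frechet_derivative (snd c' \<circ> chart_inv c) (at (snd c (\<gamma> t)))) (at ((snd c \<circ> \<gamma>) t))"
      using transition_has_derivative[OF A in_charts] by simp
    show "\<forall>\<^sub>F s in nhds t. (snd c' \<circ> chart_inv c) ((snd c \<circ> \<gamma>) s) = (snd c' \<circ> \<gamma>) s"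
      using eventually_in_open[OF cont chart_open_domain[OF ch] in_charts(1)]
      by eventually_elim (simp add: chart_inv_left[OF ch])
  qed
qed

text \<open>Compatibility of the coordinate vectors need not be checked separately: it follows from the
  chain rule as soon as they are the derivatives of one and the same curve.\<close>

lemma has_velocityI:
  assumes A: "smooth_manifold A" and cont: "continuous (at t) \<gamma>"
    and zero: "\<And>c. \<not> (c \<in> A \<and> \<gamma> t \<in> fst c) \<Longrightarrow> X c = 0"
    and deriv: "\<And>c. c \<in> A \<Longrightarrow> \<gamma> t \<in> fst c \<Longrightarrow> ((snd c \<circ> \<gamma>) has_vector_derivative X c) (at t)"
  shows "has_velocity A \<gamma> UNIV t X"
proof -
  have "X c' = frechet_derivative (snd c' \<circ> chart_inv c) (at (snd c (\<gamma> t))) (X c)"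
    if "c \<in> A" "c' \<in> A" "\<gamma> t \<in> fst c" "\<gamma> t \<in> fst c'" for c c'
    by (rule vector_derivative_unique_at[OF deriv[OF that(2,4)]
          curve_derivative_change_chart[OF A that(1,2) cont that(3,4) deriv[OF that(1,3)]]])
  with zero have "X \<in> tangent_space A (\<gamma> t)"
    unfolding tangent_space_def by blast
  with cont deriv show ?thesis
    unfolding has_velocity_def by blast
qed

lemma has_velocityI_chart:
  assumes A: "smooth_manifold A" "c \<in> A" and cont: "continuous (at t) \<gamma>"
    and X: "X \<in> tangent_space A (\<gamma> t)" and "\<gamma> t \<in> fst c"
    and deriv: "((snd c \<circ> \<gamma>) has_vector_derivative X c) (at t)"
  shows "has_velocity A \<gamma> UNIV t X"
proof (rule has_velocityI[OF A(1) cont])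
  show "X c' = 0" if "\<not> (c' \<in> A \<and> \<gamma> t \<in> fst c')" for c'
    by (rule tangent_vector_outside[OF X that])
  show "((snd c' \<circ> \<gamma>) has_vector_derivative X c') (at t)" if "c' \<in> A" "\<gamma> t \<in> fst c'" for c'
  proof -
    have "X c' = frechet_derivative (snd c' \<circ> chart_inv c) (at (snd c (\<gamma> t))) (X c)"
      by (rule tangent_vector_change_chart[OF X A(2) that(1) \<open>\<gamma> t \<in> fst c\<close> that(2)])
    then show ?thesis
      using curve_derivative_change_chart[OF A that(1) cont \<open>\<gamma> t \<in> fst c\<close> that(2) deriv] by simp
  qed
qed

lemma has_velocity_unique:
  assumes "at t within I \<noteq> bot" and X: "has_velocity A \<gamma> I t X" and Y: "has_velocity A \<gamma> I t Y"
  shows "X = Y"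
proof
  fix c
  show "X c = Y c"
  proof (cases "c \<in> A \<and> \<gamma> t \<in> fst c")
    case True
    then show ?thesis
      using X Y vector_derivative_unique_within[OF assms(1), of "snd c \<circ> \<gamma>" "X c" "Y c"]
      unfolding has_velocity_def by blast
  next
    case False
    then have "X c = 0" "Y c = 0"
      using X Y unfolding has_velocity_def by (blast intro: tangent_vector_outside)+
    then show ?thesis by simp
  qed
qed

lemma velocity_eqI:
  assumes "at t within I \<noteq> bot" and "has_velocity A \<gamma> I t X"
  shows "velocity A \<gamma> I t = X"
  unfolding velocity_def
  using assms(2) has_velocity_unique[OF assms(1) _ assms(2)] by (rule the_equality)

text \<open>At interior times the domain of a curve is irrelevant, so that velocities can be computed relative to the
  whole line.\<close>

lemma has_velocity_interior:
  assumes "t \<in> interior I"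
  shows "has_velocity A \<gamma> I t X \<longleftrightarrow> has_velocity A \<gamma> UNIV t X"
  unfolding has_velocity_def at_within_interior[OF assms] by simp

lemma has_velocity_transform:
  assumes "open I" and "t \<in> I" and "\<And>s. s \<in> I \<Longrightarrow> \<gamma> s = \<delta> s"
    and "has_velocity A \<gamma> UNIV t X"
  shows "has_velocity A \<delta> UNIV t X"
proof -
  have ev: "\<forall>\<^sub>F s in nhds t. \<gamma> s = \<delta> s"
    using assms(1-3) eventually_nhds by blast
  have "((snd c \<circ> \<delta>) has_vector_derivative u) (at t)"
    if "((snd c \<circ> \<gamma>) has_vector_derivative u) (at t)" for c :: "('a, 'b) chart" and u
    using that by (rule has_vector_derivative_transform_within_open[OF _ assms(1,2)])
      (simp add: assms(3))
  moreover have "continuous (at t) \<delta>" if "continuous (at t) \<gamma>"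
    using that isCont_cong[OF ev] by simp
  ultimately show ?thesis
    using assms(4) unfolding has_velocity_def by (simp add: assms(3)[OF assms(2)])
qed


section \<open>Product charts and partial differentials\<close>

lemma fst_prod_chart: "w \<in> fst (prod_chart cs) \<longleftrightarrow> (\<forall>i. w $ i \<in> fst (cs i))"
  by (simp add: prod_chart_def)

lemma snd_prod_chart: "snd (prod_chart cs) w = (\<chi> i. snd (cs i) (w $ i))"
  by (simp add: prod_chart_def)

lemma prod_chart_in_prod_atlas:
  assumes "\<And>i. cs i \<in> A"
  shows "prod_chart cs \<in> prod_atlas A"
  using assms unfolding prod_atlas_def by blast

lemma chart_inv_prod_chart:
  assumes ch: "\<And>i. is_chart (cs i)" and w: "w \<in> fst (prod_chart cs)"
  shows "chart_inv (prod_chart cs) (snd (prod_chart cs) w) = w"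
proof -
  have "inj_on (snd (prod_chart cs)) (fst (prod_chart cs))"
  proof (rule inj_onI)
    fix x y
    assume x: "x \<in> fst (prod_chart cs)" and y: "y \<in> fst (prod_chart cs)"
      and eq: "snd (prod_chart cs) x = snd (prod_chart cs) y"
    have "x $ i = y $ i" for i
    proof -
      have "snd (cs i) (x $ i) = snd (cs i) (y $ i)"
        using eq by (simp add: snd_prod_chart vec_eq_iff)
      then show ?thesis
        using x y chart_inv_left[OF ch[of i]] unfolding fst_prod_chart by metis
    qed
    then show "x = y" by (simp add: vec_eq_iff)
  qed
  then show ?thesis using w unfolding chart_inv_def by (rule inv_into_f_f)
qed

lemma open_prod_chart_domain:
  assumes "\<And>i. is_chart (cs i)"
  shows "open (fst (prod_chart cs))"
proof -
  have "open {w. \<forall>i. w $ i \<in> fst (cs i)}"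
    by (rule open_vector_box) (use assms chart_open_domain in blast)
  then show ?thesis by (simp add: prod_chart_def)
qed

lemma bounded_linear_axis: "bounded_linear (axis i :: 'e::real_normed_vector \<Rightarrow> 'e ^ 'm::finite)"
proof (rule bounded_linear_intro[where K = 1])
  show "axis i (x + y) = axis i x + axis i y" for x y :: 'e
    by (simp add: axis_def vec_eq_iff)
  show "axis i (r *\<^sub>R x) = r *\<^sub>R axis i x" for r and x :: 'e
    by (simp add: axis_def vec_eq_iff)
  show "norm (axis i x :: 'e ^ 'm) \<le> norm x * 1" for x :: 'e
  proof -
    have "(\<Sum>j\<in>UNIV. (norm ((axis i x :: 'e ^ 'm) $ j))\<^sup>2) = (\<Sum>j\<in>UNIV. if j = i then (norm x)\<^sup>2 else 0)"
      by (intro sum.cong) (auto simp: axis_def)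
    then show ?thesis by (simp add: norm_vec_def L2_set_def)
  qed
qed

lemma vec_eq_sum_axis: "(\<chi> i. x i) = (\<Sum>i\<in>UNIV. axis i (x i))"
proof -
  have "(\<Sum>i\<in>UNIV. axis i (x i)) $ j = (\<Sum>i\<in>UNIV. if i = j then x i else 0)" for j
    unfolding sum_component by (intro sum.cong) (auto simp: axis_def)
  then show ?thesis by (simp add: vec_eq_iff)
qed

lemma has_vector_derivative_vec_lambda:
  fixes f :: "'m::finite \<Rightarrow> real \<Rightarrow> 'e::real_normed_vector"
  assumes "\<And>i. (f i has_vector_derivative u i) F"
  shows "((\<lambda>t. \<chi> i. f i t) has_vector_derivative (\<chi> i. u i)) F"
  unfolding vec_eq_sum_axis
  by (intro has_vector_derivative_sum bounded_linear.has_vector_derivative[OF bounded_linear_axis] assms)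

lemma Ck_map_has_derivative:
  assumes "Ck_map 1 A B S f" and "c \<in> A" and "c' \<in> B" and "q \<in> S" and "q \<in> fst c" and "f q \<in> fst c'"
  shows "((snd c' \<circ> f \<circ> chart_inv c) has_derivative
           frechet_derivative (snd c' \<circ> f \<circ> chart_inv c) (at (snd c q))) (at (snd c q))"
proof -
  have "Ck_on 1 (snd c ` (S \<inter> fst c \<inter> f -` fst c')) (snd c' \<circ> f \<circ> chart_inv c)"
    using assms unfolding Ck_map_def by blast
  then have "\<forall>x\<in>snd c ` (S \<inter> fst c \<inter> f -` fst c'). (snd c' \<circ> f \<circ> chart_inv c) differentiable (at x)"
    by simp
  then show ?thesis
    using assms frechet_derivative_works by blast
qed

text \<open>Combining the base charts of the components gives the product chart in which all the partial
  differentials at a point can be compared.\<close>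

abbreviation base_prod_chart :: "('a, 'e) chart set \<Rightarrow> 'a ^ 'm::finite \<Rightarrow> ('a ^ 'm, 'e ^ 'm) chart" where
  "base_prod_chart A v \<equiv> prod_chart (\<lambda>i. base_chart A (v $ i))"

lemma base_prod_chart:
  assumes "smooth_manifold A"
  shows "base_prod_chart A v \<in> prod_atlas A" and "v \<in> fst (base_prod_chart A v)"
  using base_chart[OF assms] by (auto intro: prod_chart_in_prod_atlas simp: fst_prod_chart)

text \<open>The total derivative of \<open>F\<close> at \<open>v\<close>, from the base chart of \<open>v\<close> to the chart \<open>c'\<close>.\<close>

definition coordinate_derivative ::
    "('a, 'e::real_normed_vector) chart set \<Rightarrow> ('a ^ 'm::finite \<Rightarrow> 'b) \<Rightarrow> 'a ^ 'm \<Rightarrow>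
     ('b, 'f::real_normed_vector) chart \<Rightarrow> 'e ^ 'm \<Rightarrow> 'f" where
  "coordinate_derivative A F v c' =
     frechet_derivative (snd c' \<circ> F \<circ> chart_inv (base_prod_chart A v)) (at (snd (base_prod_chart A v) v))"

lemma coordinate_derivative:
  assumes "smooth_manifold A" and "Ck_map 1 (prod_atlas A) B W F" and "v \<in> W" and "c' \<in> B" and "F v \<in> fst c'"
  shows "((snd c' \<circ> F \<circ> chart_inv (base_prod_chart A v)) has_derivative coordinate_derivative A F v c')
           (at (snd (base_prod_chart A v) v))"
  unfolding coordinate_derivative_def
  using assms base_prod_chart by (intro Ck_map_has_derivative) auto

definition partial_differential ::
    "('a, 'e::real_normed_vector) chart set \<Rightarrow> ('b, 'f::real_normed_vector) chart set \<Rightarrow>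
     ('a ^ 'm::finite \<Rightarrow> 'b) \<Rightarrow> 'a ^ 'm \<Rightarrow> 'm \<Rightarrow> ('a, 'e) tvec \<Rightarrow> ('b, 'f) tvec" where
  "partial_differential A B F v i = differential A B (\<lambda>q. F (\<chi> j. if j = i then q else v $ j)) (v $ i)"

text \<open>In product charts, changing one argument while freezing the others is an affine map, with the embedding
  of the corresponding factor as its linear part. A partial differential is therefore the total derivative
  restricted to that factor.\<close>

lemma partial_differential_eq:
  fixes F :: "'a::{t2_space,second_countable_topology} ^ 'm::finite \<Rightarrow> 'b::topological_space"
  assumes A: "smooth_manifold A" and F: "Ck_map 1 (prod_atlas A) B W F" and v: "v \<in> W"
  shows "partial_differential A B F v i X =
    (\<lambda>c'. if c' \<in> B \<and> F v \<in> fst c'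
          then coordinate_derivative A F v c' (axis i (X (base_chart A (v $ i)))) else 0)"
proof -
  let ?c = "\<lambda>j. base_chart A (v $ j)"
  let ?ins = "\<lambda>q. \<chi> j. if j = i then q else v $ j"
  let ?x = "snd (base_prod_chart A v) v"
  \<comment> \<open>the insertion in coordinates: an affine map with linear part \<open>axis i\<close>\<close>
  let ?aff = "\<lambda>x. axis i x + (\<chi> j. if j = i then 0 else snd (?c j) (v $ j))"
  have ch: "is_chart (?c j)" for j
    by (rule smooth_manifold_chart[OF A base_chart(1)[OF A]])
  have ins_v: "?ins (v $ i) = v"
    by (auto simp: vec_eq_iff)
  have aff_v: "?aff (snd (?c i) (v $ i)) = ?x"
    by (auto simp: vec_eq_iff snd_prod_chart axis_def)
  have "frechet_derivative (snd c' \<circ> (\<lambda>q. F (?ins q)) \<circ> chart_inv (?c i)) (at (snd (?c i) (v $ i))) =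
      (\<lambda>u. coordinate_derivative A F v c' (axis i u))" if "c' \<in> B" "F v \<in> fst c'" for c'
  proof -
    have "(?aff has_derivative axis i) (at (snd (?c i) (v $ i)))"
      using bounded_linear_imp_has_derivative[OF bounded_linear_axis] by (rule has_derivative_add_const)
    from diff_chain_at[OF this] coordinate_derivative[OF A F v that]
    have "((snd c' \<circ> F \<circ> chart_inv (base_prod_chart A v) \<circ> ?aff) has_derivative
        (coordinate_derivative A F v c' \<circ> axis i)) (at (snd (?c i) (v $ i)))"
      unfolding aff_v by blast
    then have "((snd c' \<circ> (\<lambda>q. F (?ins q)) \<circ> chart_inv (?c i)) has_derivative
        (coordinate_derivative A F v c' \<circ> axis i)) (at (snd (?c i) (v $ i)))"
    proof (rule has_derivative_transform_within_open[OF _ chart_open_image[OF ch[of i]]])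
      show "snd (?c i) (v $ i) \<in> snd (?c i) ` fst (?c i)"
        using base_chart(2)[OF A] by blast
      fix x assume "x \<in> snd (?c i) ` fst (?c i)"
      then obtain q where q: "q \<in> fst (?c i)" "x = snd (?c i) q" by blast
      have "?aff x = snd (base_prod_chart A v) (?ins q)"
        using q by (auto simp: vec_eq_iff snd_prod_chart axis_def)
      moreover have "?ins q \<in> fst (base_prod_chart A v)"
        using q base_chart(2)[OF A] by (auto simp: fst_prod_chart)
      ultimately show "(snd c' \<circ> F \<circ> chart_inv (base_prod_chart A v) \<circ> ?aff) x =
          (snd c' \<circ> (\<lambda>q. F (?ins q)) \<circ> chart_inv (?c i)) x"
        using q by (simp add: chart_inv_prod_chart[OF ch] chart_inv_left[OF ch])
    qed
    from frechet_derivative_at[OF this] show ?thesis by (simp add: comp_def)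
  qed
  then show ?thesis
    unfolding partial_differential_def differential_def Let_def base_chart_def[symmetric] ins_v
    by (intro ext) simp
qed

lemma sum_fun_apply: "(\<Sum>i\<in>I. f i) x = (\<Sum>i\<in>I. f i x)"
  by (induction I rule: infinite_finite_induct) auto

text \<open>By linearity of the total derivative, its restrictions to the factors add up to the total derivative.\<close>

lemma sum_partial_differential_eq:
  fixes F :: "'a::{t2_space,second_countable_topology} ^ 'm::finite \<Rightarrow> 'b::topological_space"
  assumes A: "smooth_manifold A" and F: "Ck_map 1 (prod_atlas A) B W F" and v: "v \<in> W"
  shows "(\<Sum>i\<in>UNIV. partial_differential A B F v i (b $ i)) =
    (\<lambda>c'. if c' \<in> B \<and> F v \<in> fst c'
          then coordinate_derivative A F v c' (\<chi> i. (b $ i) (base_chart A (v $ i))) else 0)"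
proof
  fix c'
  show "(\<Sum>i\<in>UNIV. partial_differential A B F v i (b $ i)) c' = (if c' \<in> B \<and> F v \<in> fst c'
      then coordinate_derivative A F v c' (\<chi> i. (b $ i) (base_chart A (v $ i))) else 0)"
  proof (cases "c' \<in> B \<and> F v \<in> fst c'")
    case True
    then have "linear (coordinate_derivative A F v c')"
      using coordinate_derivative[OF A F v] has_derivative_linear by blast
    then show ?thesis
      using True by (simp add: sum_fun_apply partial_differential_eq[OF A F v] vec_eq_sum_axis linear_sum)
  next
    case False
    then show ?thesis
      by (simp only: sum_fun_apply partial_differential_eq[OF A F v] if_False sum.neutral_const)
  qed
qed

text \<open>The chain rule for a map on a product manifold. The curve is differentiated in the base charts of its
  components, where \<open>sum_partial_differential_eq\<close> describes the differential of the map; that the outcome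
  is a tangent vector is part of \<open>has_velocityI\<close>.\<close>

lemma has_velocity_compose:
  fixes F :: "'a::{t2_space,second_countable_topology} ^ 'm::finite \<Rightarrow>
              'b::{t2_space,second_countable_topology}"
  assumes A: "smooth_manifold A" and B: "smooth_manifold B"
    and F: "Ck_map 1 (prod_atlas A) B W F" and "open W" and v: "C t \<in> W"
    and C: "\<And>i. has_velocity A (\<lambda>t. C t $ i) UNIV t (b $ i)"
  shows "has_velocity B (\<lambda>t. F (C t)) UNIV t (\<Sum>i\<in>UNIV. partial_differential A B F (C t) i (b $ i))"
proof -
  let ?c = "base_prod_chart A (C t)"
  have ch: "is_chart (base_chart A (C t $ i))" for i
    by (rule smooth_manifold_chart[OF A base_chart(1)[OF A]])
  have contC: "continuous (at t) C"
    unfolding continuous_at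
    by (rule vec_tendstoI) (use C in \<open>simp add: has_velocity_def continuous_at\<close>)
  have "(F \<longlongrightarrow> F (C t)) (at (C t))"
    using F v at_within_open[OF v \<open>open W\<close>] unfolding Ck_map_def continuous_on_def by metis
  then have contFC: "continuous (at t) (\<lambda>t. F (C t))"
    using contC unfolding continuous_at by (rule tendsto_compose)
  have coord: "((\<lambda>s. snd ?c (C s)) has_vector_derivative
      (\<chi> i. (b $ i) (base_chart A (C t $ i)))) (at t)"
    unfolding snd_prod_chart
    by (rule has_vector_derivative_vec_lambda)
      (use C base_chart[OF A] in \<open>auto simp: has_velocity_def comp_def\<close>)
  show ?thesis
    unfolding sum_partial_differential_eq[OF A F v]
  proof (rule has_velocityI[OF B contFC])
    fix c' assume c': "c' \<in> B" "F (C t) \<in> fst c'"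
    have "((snd c' \<circ> (\<lambda>t. F (C t))) has_vector_derivative
        coordinate_derivative A F (C t) c' (\<chi> i. (b $ i) (base_chart A (C t $ i)))) (at t)"
    proof (rule has_vector_derivative_chain_eventually[OF coord coordinate_derivative[OF A F v c']])
      show "\<forall>\<^sub>F s in nhds t. (snd c' \<circ> F \<circ> chart_inv ?c) (snd ?c (C s)) = (snd c' \<circ> (\<lambda>t. F (C t))) s"
        using eventually_in_open[OF contC open_prod_chart_domain[OF ch] base_prod_chart(2)[OF A]]
        by eventually_elim (simp add: chart_inv_prod_chart[OF ch])
    qed
    then show "((snd c' \<circ> (\<lambda>t. F (C t))) has_vector_derivative
        (if c' \<in> B \<and> F (C t) \<in> fst c'
         then coordinate_derivative A F (C t) c' (\<chi> i. (b $ i) (base_chart A (C t $ i))) else 0)) (at t)"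
      using c' by simp
  qed (rule if_not_P)
qed

lemma linear_partial_differential:
  fixes F :: "'a::{t2_space,second_countable_topology} ^ 'm::finite \<Rightarrow> 'b::topological_space"
  assumes A: "smooth_manifold A" and F: "Ck_map 1 (prod_atlas A) B W F" and v: "v \<in> W"
  shows "linear (partial_differential A B F v i)"
proof -
  have lin: "linear (\<lambda>u. coordinate_derivative A F v c' (axis i u))" if "c' \<in> B" "F v \<in> fst c'" for c'
    using linear_compose[OF bounded_linear.linear[OF bounded_linear_axis]
        has_derivative_linear[OF coordinate_derivative[OF A F v that]]]
    by (simp add: comp_def)
  show ?thesis
    unfolding partial_differential_eq[OF A F v]
    by (rule linearI)
      (auto simp: fun_eq_iff scaleR_fun_def linear_add[OF lin] linear_cmul[OF lin])
qed


section \<open>Curves with given nodal velocities\<close>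

text \<open>The components of the curve are straight lines in the coordinates of the base charts. In any other
  product chart they are transition maps applied to straight lines, hence differentiable at all times.\<close>

lemma nodal_curve_exists:
  fixes A :: "('a::{t2_space,second_countable_topology}, 'e::real_normed_vector) chart set"
    and v :: "'a ^ 'm::finite"
  assumes A: "smooth_manifold A" and W: "open W" "v \<in> W" and b: "b \<in> nodal_tangent_space A v"
  obtains C :: "real \<Rightarrow> 'a ^ 'm" and \<epsilon> where "\<epsilon> > 0" and "C 0 = v"
    and "\<And>t. t \<in> {-\<epsilon><..<\<epsilon>} \<Longrightarrow> C t \<in> W"
    and "differentiable_map flat_atlas (prod_atlas A) {-\<epsilon><..<\<epsilon>} C"
    and "\<And>i. has_velocity A (\<lambda>t. C t $ i) UNIV 0 (b $ i)"
proof -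
  define c where "c i = base_chart A (v $ i)" for i
  have cA: "c i \<in> A" and vc: "v $ i \<in> fst (c i)" for i
    using base_chart[OF A] by (auto simp: c_def)
  have ch: "is_chart (c i)" for i by (rule smooth_manifold_chart[OF A cA])
  define line where "line i t = snd (c i) (v $ i) + t *\<^sub>R (b $ i) (c i)" for i and t :: real
  define C where "C t = (\<chi> i. chart_inv (c i) (line i t))" for t
  define S where "S = (\<Inter>i. line i -` (snd (c i) ` fst (c i)))"
  have line_deriv: "(line i has_vector_derivative (b $ i) (c i)) (at t)" for i t
    unfolding line_def by (auto intro!: derivative_eq_intros)
  have line_cont: "continuous_on I (line i)" for i I
    unfolding line_def by (intro continuous_intros)
  have S: "line i t \<in> snd (c i) ` fst (c i)" if "t \<in> S" for i t
    using that by (auto simp: S_def)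
  have "open S"
    unfolding S_def using open_vimage[OF chart_open_image[OF ch] line_cont]
    by (intro open_INT) auto
  have "0 \<in> S"
    using vc by (auto simp: S_def line_def)
  have C0: "C 0 = v"
    using chart_inv_left[OF ch vc] by (simp add: C_def line_def vec_eq_iff)
  have C_cont: "continuous_on S C"
    unfolding C_def
  proof (intro continuous_on_vec_lambda)
    show "continuous_on S (\<lambda>t. chart_inv (c i) (line i t))" for i
      using S by (intro continuous_on_compose2[OF chart_inv_continuous[OF ch[of i]] line_cont]) auto
  qed
  have "open (S \<inter> C -` W)"
    by (rule continuous_open_preimage[OF C_cont \<open>open S\<close> W(1)])
  moreover have "0 \<in> S \<inter> C -` W"
    using \<open>0 \<in> S\<close> W(2) C0 by simp
  ultimately obtain \<epsilon> where "\<epsilon> > 0" and "ball 0 \<epsilon> \<subseteq> S \<inter> C -` W"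
    using open_contains_ball by blast
  moreover have "ball 0 \<epsilon> = {-\<epsilon><..<\<epsilon>}"
    by (auto simp: dist_real_def)
  ultimately have \<epsilon>: "{-\<epsilon><..<\<epsilon>} \<subseteq> S \<inter> C -` W" by simp
  have coord_deriv: "((snd c' \<circ> (\<lambda>t. C t $ i)) has_vector_derivative
      frechet_derivative (snd c' \<circ> chart_inv (c i)) (at (line i t)) ((b $ i) (c i))) (at t)"
    if t: "t \<in> S" and c': "c' \<in> A" "C t $ i \<in> fst c'" for t i c'
  proof -
    note inv = chart_inv_right[OF ch S[OF t]]
    have "((snd c' \<circ> chart_inv (c i)) has_derivative
        frechet_derivative (snd c' \<circ> chart_inv (c i)) (at (line i t))) (at (line i t))"
      using transition_has_derivative[OF A cA[of i] c'(1) inv(2)] c'(2) inv(1) by (simp add: C_def)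
    then show ?thesis
      by (rule has_vector_derivative_chain_eventually[OF line_deriv]) (simp add: C_def)
  qed
  have "differentiable_map flat_atlas (prod_atlas A) {-\<epsilon><..<\<epsilon>} C"
    unfolding differentiable_map_def
  proof (intro conjI ballI impI)
    show "continuous_on {-\<epsilon><..<\<epsilon>} C"
      using C_cont \<epsilon> by (auto intro: continuous_on_subset)
    fix c0 :: "(real, real) chart" and c' :: "('a ^ 'm, 'e ^ 'm) chart" and t :: real
    assume c0: "c0 \<in> flat_atlas" and "c' \<in> prod_atlas A"
      and t: "t \<in> {-\<epsilon><..<\<epsilon>} \<inter> fst c0" and Ct: "C t \<in> fst c'"
    then obtain cs where cs: "c' = prod_chart cs" "\<And>i. cs i \<in> A"
      unfolding prod_atlas_def by blast
    have snd_C: "snd c' \<circ> C = (\<lambda>s. \<chi> i. (snd (cs i) \<circ> (\<lambda>t. C t $ i)) s)"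
      by (simp add: cs(1) snd_prod_chart comp_def)
    have "((\<lambda>s. \<chi> i. (snd (cs i) \<circ> (\<lambda>t. C t $ i)) s) has_vector_derivative
        (\<chi> i. frechet_derivative (snd (cs i) \<circ> chart_inv (c i)) (at (line i t)) ((b $ i) (c i)))) (at t)"
      using t \<epsilon> Ct cs by (intro has_vector_derivative_vec_lambda coord_deriv) (auto simp: fst_prod_chart)
    then have "(snd c' \<circ> C) differentiable (at t)"
      unfolding snd_C by (rule differentiableI_vector)
    moreover have "chart_inv c0 = id" "snd c0 = id"
      using c0 by (simp_all add: flat_atlas_def flat_chart_def chart_inv_def)
    ultimately show "(snd c' \<circ> C \<circ> chart_inv c0) differentiable (at (snd c0 t))"
      by simp
  qed
  moreover have "has_velocity A (\<lambda>t. C t $ i) UNIV 0 (b $ i)" for i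
  proof (rule has_velocityI_chart[OF A cA[of i]])
    have "continuous (at 0) C"
      using C_cont \<open>open S\<close> \<open>0 \<in> S\<close> by (simp add: continuous_on_eq_continuous_at)
    then show "continuous (at 0) (\<lambda>t. C t $ i)" by (rule isCont_vec_nth)
    show "b $ i \<in> tangent_space A (C 0 $ i)"
      using b by (simp add: C0 nodal_tangent_space_def)
    show "C 0 $ i \<in> fst (c i)" by (simp add: C0 vc)
    show "((snd (c i) \<circ> (\<lambda>t. C t $ i)) has_vector_derivative (b $ i) (c i)) (at 0)"
      using line_deriv[of i 0]
    proof (rule has_vector_derivative_transform_within_open[OF _ \<open>open S\<close> \<open>0 \<in> S\<close>])
      show "line i s = (snd (c i) \<circ> (\<lambda>t. C t $ i)) s" if "s \<in> S" for s
        using chart_inv_right(1)[OF ch S[OF that]] by (simp add: C_def)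
    qed
  qed
  ultimately show ?thesis
    using \<open>\<epsilon> > 0\<close> C0 \<epsilon> by (intro that[of \<epsilon> C]) auto
qed


section \<open>Reproduction of nodal values\<close>

lemma interp_eqI:
  assumes "\<exists>!q. R w \<xi> q" and "R w \<xi> q"
  shows "interp R w \<xi> = q"
  unfolding interp_def using assms by (rule the1_equality)

lemma riemannian_metric_zero:
  assumes "smooth_manifold A" and "riemannian_metric A g"
  shows "g q 0 0 = 0"
proof -
  have "g q (0 *\<^sub>R 0) 0 = 0 * g q 0 0"
    using assms(2) zero_tangent[OF assms(1)] unfolding riemannian_metric_def by blast
  then show ?thesis by simp
qed

lemma riemannian_metric_nonneg:
  assumes "smooth_manifold A" and "riemannian_metric A g" and "X \<in> tangent_space A q"
  shows "g q X X \<ge> 0"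
proof (cases "X = 0")
  case True
  then show ?thesis using riemannian_metric_zero[OF assms(1,2)] by simp
next
  case False
  then have "g q X X > 0"
    using assms(2,3) unfolding riemannian_metric_def by blast
  then show ?thesis by simp
qed

lemma at_within_Icc_neq_bot:
  fixes s t \<tau> :: real
  assumes "s < t" and "\<tau> \<in> {s..t}"
  shows "at \<tau> within {s..t} \<noteq> bot"
  using assms by (simp add: trivial_limit_within)

lemma constant_curve_has_velocity:
  assumes "smooth_manifold A"
  shows "has_velocity A (\<lambda>_. q) I t 0"
  using zero_tangent[OF assms] by (auto simp: has_velocity_def comp_def)

lemma constant_curve_velocity:
  assumes "smooth_manifold A" and "s < t" and "\<tau> \<in> {s..t}"
  shows "velocity A (\<lambda>_. q) {s..t} \<tau> = 0"
  by (rule velocity_eqI[OF at_within_Icc_neq_bot[OF assms(2,3)] constant_curve_has_velocity[OF assms(1)]])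

lemma piecewise_C1_curve_constant:
  assumes "smooth_manifold A"
  shows "piecewise_C1_curve A (\<lambda>_. q)"
proof -
  have "C1_curve A s t (\<lambda>_. q)" if "s < t" for s t
    unfolding C1_curve_def
  proof (intro conjI ballI)
    show "\<exists>X. has_velocity A (\<lambda>_. q) {s..t} \<tau> X" for \<tau>
      using constant_curve_has_velocity[OF assms] by blast
    show "continuous_on {\<tau> \<in> {s..t}. q \<in> fst c} (\<lambda>\<tau>. velocity A (\<lambda>_. q) {s..t} \<tau> c)" for c
    proof (rule continuous_on_eq[OF continuous_on_const[of _ 0]])
      show "0 = velocity A (\<lambda>_. q) {s..t} \<tau> c" if "\<tau> \<in> {\<tau> \<in> {s..t}. q \<in> fst c}" for \<tau>
        using constant_curve_velocity[OF assms \<open>s < t\<close>, of \<tau> q] that by simp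
    qed
  qed
  then show ?thesis
    unfolding piecewise_C1_curve_def by auto
qed

text \<open>Away from the end points and the finitely many break points the velocity is a tangent vector, so
  that the integrand is nonnegative there; at the exceptional points the integrand can be arbitrary.\<close>

lemma curve_length_nonneg:
  assumes A: "smooth_manifold A" and g: "riemannian_metric A g" and "piecewise_C1_curve A \<gamma>"
  shows "curve_length A g \<gamma> \<ge> 0"
proof -
  let ?f = "\<lambda>t. sqrt (g (\<gamma> t) (velocity A \<gamma> {0..1} t) (velocity A \<gamma> {0..1} t))"
  obtain S where S: "finite S"
    "\<And>s t. 0 \<le> s \<Longrightarrow> s < t \<Longrightarrow> t \<le> 1 \<Longrightarrow> {s<..<t} \<inter> S = {} \<Longrightarrow> C1_curve A s t \<gamma>"
    using assms(3) unfolding piecewise_C1_curve_def by blast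
  have nonneg: "?f \<tau> \<ge> 0" if \<tau>: "\<tau> \<in> {0..1} - (S \<union> {0,1})" for \<tau>
  proof -
    have "open ({0<..<1} - S)"
      using S(1) by (intro open_Diff finite_imp_closed) auto
    moreover have "\<tau> \<in> {0<..<1} - S" using \<tau> by auto
    ultimately obtain e where e: "e > 0" "cball \<tau> e \<subseteq> {0<..<1} - S"
      using open_contains_cball by blast
    have sub: "{\<tau> - e..\<tau> + e} \<subseteq> {0<..<1} - S"
      using e(2) by (simp add: cball_eq_atLeastAtMost)
    moreover have "\<tau> - e \<in> {\<tau> - e..\<tau> + e}" "\<tau> + e \<in> {\<tau> - e..\<tau> + e}" using e(1) by auto
    ultimately have "\<tau> - e \<in> {0<..<1}" "\<tau> + e \<in> {0<..<1}" by blast+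
    moreover have "{\<tau> - e<..<\<tau> + e} \<inter> S = {}"
    proof -
      have "{\<tau> - e<..<\<tau> + e} \<subseteq> {\<tau> - e..\<tau> + e}" by auto
      then show ?thesis using sub by blast
    qed
    ultimately have "C1_curve A (\<tau> - e) (\<tau> + e) \<gamma>"
      using e(1) by (intro S(2)) auto
    then obtain X where "has_velocity A \<gamma> {\<tau> - e..\<tau> + e} \<tau> X"
      using e(1) unfolding C1_curve_def by force
    then have "has_velocity A \<gamma> UNIV \<tau> X"
      using e(1) by (subst (asm) has_velocity_interior) (auto simp: interior_atLeastAtMost_real)
    then have X: "has_velocity A \<gamma> {0..1} \<tau> X"
      using \<open>\<tau> \<in> {0<..<1} - S\<close>
      by (subst has_velocity_interior) (auto simp: interior_atLeastAtMost_real)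
    then have "velocity A \<gamma> {0..1} \<tau> = X"
      using \<tau> by (intro velocity_eqI at_within_Icc_neq_bot) auto
    moreover have "X \<in> tangent_space A (\<gamma> \<tau>)"
      using X by (simp add: has_velocity_def)
    ultimately show ?thesis
      using riemannian_metric_nonneg[OF A g] by simp
  qed
  \<comment> \<open>cutting the integrand off at zero changes it at the finitely many exceptional points only\<close>
  have "curve_length A g \<gamma> = integral {0..1} (\<lambda>t. max 0 (?f t))"
    unfolding curve_length_def
  proof (rule integral_spike)
    show "negligible (S \<union> {0,1})" using S(1) by (intro negligible_finite) simp
    show "max 0 (?f t) = ?f t" if "t \<in> {0..1} - (S \<union> {0,1})" for t
      using nonneg[OF that] by simp
  qed
  also have "\<dots> \<ge> 0"
  proof (cases "(\<lambda>t. max 0 (?f t)) integrable_on {0..1}")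
    case True
    then show ?thesis by (intro Henstock_Kurzweil_Integration.integral_nonneg) auto
  next
    case False
    then show ?thesis by (simp add: not_integrable_integral)
  qed
  finally show ?thesis .
qed

lemma riemannian_dist_self:
  assumes A: "smooth_manifold A" and g: "riemannian_metric A g"
  shows "riemannian_dist A g q q = 0"
proof -
  have "curve_length A g (\<lambda>_. q) = integral {0..1} (\<lambda>_::real. 0::real)"
    unfolding curve_length_def
    by (rule integral_cong)
      (simp add: constant_curve_velocity[OF A] riemannian_metric_zero[OF A g])
  then have "0 \<in> {curve_length A g \<gamma> | \<gamma>. piecewise_C1_curve A \<gamma> \<and> \<gamma> 0 = q \<and> \<gamma> 1 = q}"
    using piecewise_C1_curve_constant[OF A, of q] by force
  then show ?thesis
    unfolding riemannian_dist_def
    using curve_length_nonneg[OF A g] by (intro cInf_eq_minimum) auto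
qed

text \<open>At a node all weights but one vanish. The geodesic functional is then a single squared distance,
  which is smallest where it is zero, and the projection is applied to a point of the embedded manifold.\<close>

lemma geometric_interpolation_rule_node:
  fixes \<phi> :: "'m::finite \<Rightarrow> real ^ 'd::finite \<Rightarrow> real"
  assumes M: "riemannian_manifold A g" and R: "geometric_interpolation_rule A g \<iota> U P \<phi> R"
    and \<phi>: "\<And>i. \<phi> i (a j) = (if i = j then 1 else 0)"
  shows "R w (a j) (w $ j)"
proof -
  have weight: "(\<Sum>i\<in>UNIV. \<phi> i (a j) * f i) = f j" for f
  proof -
    have "(\<Sum>i\<in>UNIV. \<phi> i (a j) * f i) = (\<Sum>i\<in>UNIV. if i = j then f i else 0)"
      by (intro sum.cong) (auto simp: \<phi>)
    then show ?thesis by simp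
  qed
  from R consider "R = geodesic_rule A g \<phi>" |
      "differentiable_projection A \<iota> U P" "R = projection_rule \<iota> U P \<phi>"
    unfolding geometric_interpolation_rule_def by blast
  then show ?thesis
  proof cases
    case 1
    have "riemannian_dist A g (w $ j) (w $ j) = 0"
      using M riemannian_dist_self unfolding riemannian_manifold_def by blast
    then show ?thesis
      by (simp add: 1 geodesic_rule_def is_arg_min_def weight not_less)
  next
    case 2
    have "(\<Sum>i\<in>UNIV. \<phi> i (a j) *\<^sub>R \<iota> (w $ i)) = (\<Sum>i\<in>UNIV. if i = j then \<iota> (w $ i) else 0)"
      by (intro sum.cong) (auto simp: \<phi>)
    then have "(\<Sum>i\<in>UNIV. \<phi> i (a j) *\<^sub>R \<iota> (w $ i)) = \<iota> (w $ j)" by simp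
    then show ?thesis
      using 2 by (auto simp: projection_rule_def differentiable_projection_def)
  qed
qed


section \<open>Variations\<close>

text \<open>What the argument uses of a geometric interpolation: it is well posed near the nodal values \<open>v\<close>, and it
  takes the prescribed values at the nodes.\<close>

locale nodal_interpolation =
  fixes A :: "('a::{t2_space,second_countable_topology}, 'e::real_normed_vector) chart set"
    and R :: "('a, 'm::finite, 'd::finite) interpolation_rule"
    and T :: "(real ^ 'd) set"
    and a :: "'m \<Rightarrow> real ^ 'd"
    and W :: "('a ^ 'm) set"
    and v :: "'a ^ 'm"
  assumes manifold: "smooth_manifold A"
    and open_W: "open W" and v_in_W: "v \<in> W"
    and well_posed: "well_posed_on A R T W"
    and node_in_closure: "a j \<in> closure T"
    and interp_node: "w \<in> W \<Longrightarrow> interp R w (a j) = w $ j"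
begin

lemma interp_C1: "\<xi> \<in> closure T \<Longrightarrow> Ck_map 1 (prod_atlas A) A W (\<lambda>w. interp R w \<xi>)"
  using well_posed unfolding well_posed_on_def by blast

lemma interp_fun_eq: "\<xi> \<in> closure T \<Longrightarrow> interp_fun R T w \<xi> = interp R w \<xi>"
  by (simp add: interp_fun_def)

lemma interp_partial_eq: "interp_partial A R v \<xi> = partial_differential A A (\<lambda>w. interp R w \<xi>) v"
  by (intro ext) (simp add: interp_partial_def partial_differential_def)

lemma linear_variation_map: "linear (variation_map A R T v)"
proof -
  have lin: "linear (interp_partial A R v \<xi> i)" if "\<xi> \<in> closure T" for \<xi> i
    unfolding interp_partial_eq
    by (rule linear_partial_differential[OF manifold interp_C1[OF that] v_in_W])
  show ?thesis
  proof (rule linearI)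
    show "variation_map A R T v (b + b') = variation_map A R T v b + variation_map A R T v b'" for b b'
      by (rule ext) (simp add: variation_map_def linear_add[OF lin] sum.distrib)
    show "variation_map A R T v (r *\<^sub>R b) = r *\<^sub>R variation_map A R T v b" for r b
      unfolding scaleR_fun_def[of r "variation_map A R T v b"]
      by (rule ext) (simp add: variation_map_def linear_cmul[OF lin] scaleR_sum_right)
  qed
qed

lemma nodal_curve_velocity:
  assumes "C 0 = v" and "\<And>i. has_velocity A (\<lambda>t. C t $ i) UNIV 0 (b $ i)" and "\<xi> \<in> closure T"
  shows "has_velocity A (\<lambda>t. interp R (C t) \<xi>) UNIV 0 (variation_map A R T v b \<xi>)"
proof -
  have "has_velocity A (\<lambda>t. interp R (C t) \<xi>) UNIV 0
      (\<Sum>i\<in>UNIV. partial_differential A A (\<lambda>w. interp R w \<xi>) (C 0) i (b $ i))"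
    by (rule has_velocity_compose[OF manifold manifold interp_C1[OF assms(3)] open_W])
      (use assms(1,2) v_in_W in auto)
  then show ?thesis
    using assms(1,3) by (simp add: variation_map_def interp_partial_eq)
qed

text \<open>The curve of interpolants is induced by nodal values moving along a curve with velocity \<open>b\<close>.\<close>

lemma variation_map_in_variations:
  assumes b: "b \<in> nodal_tangent_space A v"
  shows "variation_map A R T v b \<in> variations A R T a W v"
proof -
  from nodal_curve_exists[OF manifold open_W v_in_W b]
  obtain C and \<epsilon> :: real where \<epsilon>: "\<epsilon> > 0" and C0: "C 0 = v"
    and CW: "\<And>t. t \<in> {-\<epsilon><..<\<epsilon>} \<Longrightarrow> C t \<in> W"
    and C: "differentiable_map flat_atlas (prod_atlas A) {-\<epsilon><..<\<epsilon>} C"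
    and vel: "\<And>i. has_velocity A (\<lambda>t. C t $ i) UNIV 0 (b $ i)" by blast
  let ?c = "\<lambda>t. interp_fun R T (C t)"
  have "differentiable_interp_curve A R T a W v \<epsilon> ?c"
    unfolding differentiable_interp_curve_def
  proof (intro conjI ballI exI[of _ C])
    fix t assume t: "t \<in> {-\<epsilon><..<\<epsilon>}"
    show "?c t \<in> interp_space R T"
      using well_posed CW[OF t] unfolding interp_space_def well_posed_on_def by blast
    show "C t = (\<chi> j. ?c t (a j))"
      using interp_node[OF CW[OF t]] by (simp add: interp_fun_eq[OF node_in_closure] vec_eq_iff)
  qed (use C0 C CW in auto)
  moreover have vel': "has_velocity A (\<lambda>t. ?c t \<xi>) {-\<epsilon><..<\<epsilon>} 0 (variation_map A R T v b \<xi>)"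
    if "\<xi> \<in> closure T" for \<xi>
    using nodal_curve_velocity[OF C0 vel that] \<epsilon>
    by (subst has_velocity_interior) (simp_all add: interior_open interp_fun_eq[OF that])
  moreover have "variation_map A R T v b \<in> fields_along A T (interp_fun R T v)"
    unfolding fields_along_def
    using vel' C0 by (auto simp: has_velocity_def variation_map_def)
  ultimately show ?thesis
    unfolding variations_def mem_Collect_eq
    by (intro conjI exI[of _ \<epsilon>] exI[of _ ?c] ballI) (use \<epsilon> C0 in \<open>simp_all only:\<close>)
qed

text \<open>The value of the interpolation at a node is the value prescribed there, so the nodal values of the
  field are the prescribed velocities. This makes evaluation at the nodes a left inverse.\<close>

lemma variation_map_at_node:
  assumes b: "b \<in> nodal_tangent_space A v"
  shows "variation_map A R T v b (a j) = b $ j"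
proof -
  from nodal_curve_exists[OF manifold open_W v_in_W b]
  obtain C and \<epsilon> :: real where \<epsilon>: "\<epsilon> > 0" and C0: "C 0 = v"
    and CW: "\<And>t. t \<in> {-\<epsilon><..<\<epsilon>} \<Longrightarrow> C t \<in> W"
    and vel: "\<And>i. has_velocity A (\<lambda>t. C t $ i) UNIV 0 (b $ i)" by blast
  have "has_velocity A (\<lambda>t. C t $ j) UNIV 0 (variation_map A R T v b (a j))"
    by (rule has_velocity_transform[OF _ _ _ nodal_curve_velocity[OF C0 vel node_in_closure],
          where I = "{-\<epsilon><..<\<epsilon>}"])
      (use \<epsilon> CW interp_node in auto)
  then show ?thesis
    using has_velocity_unique[OF _ _ vel[of j]] by simp
qed

text \<open>Evaluation at the nodes is also a right inverse: a variation comes from a curve of nodal values, whose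
  velocity is the restriction of the variation to the nodes, and the chain rule recovers the variation
  from this velocity.\<close>

lemma variation_from_nodes:
  assumes \<eta>: "\<eta> \<in> variations A R T a W v"
  shows "(\<chi> j. \<eta> (a j)) \<in> nodal_tangent_space A v"
    and "variation_map A R T v (\<chi> j. \<eta> (a j)) = \<eta>"
proof -
  let ?b = "\<chi> j. \<eta> (a j)"
  obtain \<epsilon> :: real and c where \<epsilon>: "\<epsilon> > 0" and c: "differentiable_interp_curve A R T a W v \<epsilon> c"
    and vel: "\<And>\<xi>. \<xi> \<in> closure T \<Longrightarrow> has_velocity A (\<lambda>t. c t \<xi>) {-\<epsilon><..<\<epsilon>} 0 (\<eta> \<xi>)"
    and fields: "\<eta> \<in> fields_along A T (interp_fun R T v)"
    using \<eta> unfolding variations_def by blast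
  obtain C where C0: "C 0 = v"
    and C: "\<And>t. t \<in> {-\<epsilon><..<\<epsilon>} \<Longrightarrow> c t = interp_fun R T (C t) \<and> C t = (\<chi> j. c t (a j))"
    using c unfolding differentiable_interp_curve_def by blast
  let ?I = "{-\<epsilon><..<\<epsilon>}"
  have "0 \<in> ?I" using \<epsilon> by simp
  have vel: "has_velocity A (\<lambda>t. c t \<xi>) UNIV 0 (\<eta> \<xi>)" if "\<xi> \<in> closure T" for \<xi>
    using vel[OF that] \<open>0 \<in> ?I\<close> by (subst (asm) has_velocity_interior) (simp_all add: interior_open)
  have velC: "has_velocity A (\<lambda>t. C t $ j) UNIV 0 (?b $ j)" for j
  proof (rule has_velocity_transform[OF _ \<open>0 \<in> ?I\<close>])
    show "has_velocity A (\<lambda>t. c t (a j)) UNIV 0 (?b $ j)"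
      using vel[OF node_in_closure] by simp
    show "c s (a j) = C s $ j" if "s \<in> ?I" for s
      using C[OF that] by (metis vec_lambda_beta)
  qed simp
  then show "?b \<in> nodal_tangent_space A v"
    using C0 unfolding has_velocity_def nodal_tangent_space_def by simp
  show "variation_map A R T v ?b = \<eta>"
  proof
    fix \<xi>
    show "variation_map A R T v ?b \<xi> = \<eta> \<xi>"
    proof (cases "\<xi> \<in> closure T")
      case True
      have "has_velocity A (\<lambda>t. interp R (C t) \<xi>) UNIV 0 (\<eta> \<xi>)"
      proof (rule has_velocity_transform[OF _ \<open>0 \<in> ?I\<close> _ vel[OF True]])
        show "c s \<xi> = interp R (C s) \<xi>" if "s \<in> ?I" for s
          using C[OF that] interp_fun_eq[OF True] by metis
      qed simp
      then show ?thesis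
        using has_velocity_unique[OF _ nodal_curve_velocity[OF C0 velC True]] by simp
    next
      case False
      then show ?thesis
        using fields by (simp add: variation_map_def fields_along_def)
    qed
  qed
qed

lemma subspace_nodal_tangent_space: "subspace (nodal_tangent_space A v)"
  using subspace_tangent_space[OF manifold]
  by (auto simp: subspace_def nodal_tangent_space_def)

lemma bij_betw_variation_map:
  "bij_betw (variation_map A R T v) (nodal_tangent_space A v) (variations A R T a W v)"
proof (rule bij_betw_byWitness[where f' = "\<lambda>\<eta>. \<chi> j. \<eta> (a j)"])
  show "\<forall>b\<in>nodal_tangent_space A v. (\<chi> j. variation_map A R T v b (a j)) = b"
    using variation_map_at_node by (simp add: vec_eq_iff)
qed (use variation_from_nodes variation_map_in_variations in auto)

lemma subspace_variations: "subspace (variations A R T a W v)"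
  using linear_subspace_image[OF linear_variation_map subspace_nodal_tangent_space]
    bij_betw_imp_surj_on[OF bij_betw_variation_map]
  by simp

lemma variation_map_iso:
  "vector_space_iso_on (variation_map A R T v) (nodal_tangent_space A v) (variations A R T a W v)"
  unfolding vector_space_iso_on_def
  using subspace_nodal_tangent_space subspace_variations bij_betw_variation_map
    linear_add[OF linear_variation_map] linear_cmul[OF linear_variation_map]
  by blast

end

theorem lemma3p1:
  fixes A :: "('a::{t2_space,second_countable_topology}, 'e::real_normed_vector) chart set"
    and g :: "('a, 'e) metric_tensor"
    and T :: "(real ^ 'd::finite) set"
    and p :: nat
    and a :: "'m::finite \<Rightarrow> real ^ 'd"
    and \<phi> :: "'m \<Rightarrow> real ^ 'd \<Rightarrow> real"
    and \<iota> :: "'a \<Rightarrow> real ^ 'n::finite"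
    and U :: "(real ^ 'n) set"
    and P :: "real ^ 'n \<Rightarrow> 'a"
    and R :: "('a, 'm, 'd) interpolation_rule"
    and v :: "'a ^ 'm"
    and W :: "('a ^ 'm) set"
  assumes "riemannian_manifold A g" and "connected (UNIV :: 'a set)"
    and "open T" and "connected T" and "T \<noteq> {}" and "bounded T"
    and "lagrange_basis p T a \<phi>"
    and "geometric_interpolation_rule A g \<iota> U P \<phi> R"
    and "open W" and "v \<in> W" and "well_posed_on A R T W"
  shows "subspace (variations A R T a W v) \<and>
         vector_space_iso_on (variation_map A R T v)
           (nodal_tangent_space A v) (variations A R T a W v)"
proof -
  have nodes: "a j \<in> closure T" and weights: "\<phi> i (a j) = (if i = j then 1 else 0)" for i j
    using assms(7) by (auto simp: lagrange_basis_def)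
  interpret nodal_interpolation A R T a W v
  proof
    show "smooth_manifold A" using assms(1) by (simp add: riemannian_manifold_def)
    show "interp R w (a j) = w $ j" if "w \<in> W" for w j
    proof (rule interp_eqI)
      show "\<exists>!q. R w (a j) q"
        using assms(11) that nodes unfolding well_posed_on_def by blast
      show "R w (a j) (w $ j)"
        by (rule geometric_interpolation_rule_node[OF assms(1,8) weights])
    qed
  qed (use assms nodes in auto)
  show ?thesis using subspace_variations variation_map_iso by blast
qed

end
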